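(* Let $\alpha_{3,5}=\sum_{n\geqslant 1}\frac{1}{5^n3^{5^n}}$, and let its base-$3$ expansion be given by $\alpha_{3,5}=\sum_{k\geqslant 1}a_k3^{-k}$, with $a_k\in\{0,1,2\}$. Then for all integers $n\geqslant 0$ one has (i) $$\sum_{k=5^{n+1}+1}^{5^{n+1}+4\cdot 5^n}\left(e^{\frac{2\pi i}{3}}\right)^{a_k}=(-1)^n e^{\frac{2\pi i}{3}};$$ (ii) $a_k=a_{4\cdot 5^n+k}=a_{8\cdot 5^n+k}=a_{12\cdot 5^n+k}=a_{16\cdot 5^n+k}$ for $k=5^{n+1}+j$, with $j=1,\ldots,4\cdot 5^n$.
   Context: Here $i$ denotes the imaginary unit. The number $\alpha_{3,5}$ is the Stoneham number with parameters $b=3$, $c=5$; in general, for coprime integers $b,c\geqslant 2$, $\alpha_{b,c}=\sum_{n\geqslant 1}\frac{1}{c^nb^{c^n}}$. The base-$3$ expansion is the usual digit expansion. *)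

theory Defs
  imports Complex_Main
begin

text \<open>
  The Stoneham number with parameters \<open>b\<close> and \<open>c\<close> (intended for coprime
  \<open>b, c \<ge> 2\<close>, where the series converges). The series runs over
  \<open>n \<ge> 1\<close>, hence the shift by \<open>Suc\<close>.
\<close>

definition stoneham :: "nat \<Rightarrow> nat \<Rightarrow> real" where
  "stoneham b c = (\<Sum>n. 1 / (real c ^ Suc n * real b ^ (c ^ Suc n)))"

text \<open>
  The digits are indexed from \<open>1\<close>; \<open>a 0\<close> is not constrained.
  Expansions ending in the constant digit \<open>b - 1\<close> are not excluded, so a number
  with a terminating expansion has two of them.
\<close>

definition is_base_expansion :: "nat \<Rightarrow> (nat \<Rightarrow> nat) \<Rightarrow> real \<Rightarrow> bool" where
  "is_base_expansion b a x \<longleftrightarrow>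
     (\<forall>k\<ge>1. a k \<in> {0..<b}) \<and> (\<lambda>k. real (a (Suc k)) / real b ^ Suc k) sums x"

end

theory Submission
  imports Defs "HOL-Number_Theory.Number_Theory"
begin

text \<open>
  Put \<open>q = 5 ^ N\<close>. Multiplying the Stoneham series by \<open>3 ^ m\<close> with
  \<open>5 ^ N \<le> m \<le> 5 ^ Suc N\<close> turns its first \<open>N\<close> terms into a fraction
  \<open>P\<^sub>m / q\<close> with integer numerator, and leaves a positive remainder below
  \<open>1 / q\<close>, which is too small to reach the next integer
  (\<open>scaled_stoneham_decomposition\<close>). Hence the integer part of \<open>3 ^ m * \<alpha>\<close> is
  \<open>P\<^sub>m div q\<close>. As \<open>P\<^sub>m\<close> gains a factor \<open>3\<close> whenever \<open>m\<close> grows by one, the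
  digit at position \<open>m + 1\<close> is the leading ternary digit of the fraction
  \<open>(P\<^sub>m mod q) / q\<close> (\<open>stoneham_digit\<close>): in the block between \<open>5 ^ N\<close> and
  \<open>5 ^ Suc N\<close> the number looks like a rational with denominator \<open>q\<close>. By Euler's
  theorem the digits there repeat with period \<open>totient q = 4 * 5 ^ (N - 1)\<close>, and
  the block contains five such periods.

  For the exponential sum, \<open>3\<close> is a primitive root modulo every power of \<open>5\<close>, and
  \<open>P\<^sub>m\<close> is prime to \<open>5\<close>. So over one period \<open>P\<^sub>m mod q\<close> runs through all residues
  prime to \<open>5\<close>, each once, and the sum is that of \<open>\<omega> ^ (3 * r div q)\<close> over these
  residues. Adding the multiples of \<open>5\<close> completes it to a sum over all \<open>r < q\<close>,
  while the part added is the complete sum for the modulus \<open>q / 5\<close>. A complete sum for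
  a modulus \<open>M\<close> consists of three runs of almost equal length, of ones, of \<open>\<omega>\<close> and
  of \<open>\<omega>\<^sup>2\<close>; because \<open>1 + \<omega> + \<omega>\<^sup>2 = 0\<close> it depends on \<open>M mod 3\<close> only, being
  \<open>1\<close> or \<open>1 + \<omega>\<close>. Since \<open>5 ^ n mod 3\<close> alternates between \<open>1\<close> and \<open>2\<close>, the
  difference of two consecutive complete sums is \<open>\<omega>\<close> and \<open>- \<omega>\<close> in turn.
\<close>

section \<open>Digits from an approximating fraction\<close>

text \<open>
  The part of the expansion beyond position \<open>m\<close>, scaled by \<open>b ^ m\<close>, lies in the closed
  interval from \<open>0\<close> to \<open>1\<close>. Both ends can occur for expansions that are eventually
  constant, so this alone does not identify the truncation with an integer part.
\<close>

lemma base_expansion_truncation_bounds: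
  assumes exp: "is_base_expansion b a x" and b: "b \<ge> 2"
  defines "S \<equiv> \<lambda>m. \<Sum>i<m. a (Suc i) * b ^ (m - Suc i)"
  shows "real (S m) \<le> real b ^ m * x" "real b ^ m * x \<le> real (S m) + 1"
proof -
  define f where "f = (\<lambda>k. real (a (Suc k)) / real b ^ Suc k)"
  have digit: "a (Suc k) < b" for k
    using exp by (simp add: is_base_expansion_def)
  have sums: "f sums x"
    using exp by (simp add: is_base_expansion_def f_def)
  then have summable: "summable (\<lambda>k. f (k + m))"
    by (simp add: sums_iff)
  have x: "x = (\<Sum>k. f (k + m)) + (\<Sum>k<m. f k)"
    using sums suminf_split_initial_segment[of f m] by (simp add: sums_iff)
  have head: "real b ^ m * (\<Sum>k<m. f k) = real (S m)"
    unfolding S_def f_def sum_distrib_left of_nat_sum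
  proof (rule sum.cong)
    fix i assume "i \<in> {..<m}"
    then have "real b ^ m = real b ^ (m - Suc i) * real b ^ Suc i"
      by (simp del: power_Suc flip: power_add)
    then show "real b ^ m * (real (a (Suc i)) / real b ^ Suc i)
        = real (a (Suc i) * b ^ (m - Suc i))"
      using b by simp
  qed simp
  have geom: "(\<lambda>k. (real b - 1) / real b * (1 / real b) ^ k) sums 1"
    using sums_mult[OF geometric_sums[of "1 / real b"], of "(real b - 1) / real b"] b
    by (simp add: field_simps)
  have tail_term: "real b ^ m * f (k + m) = real (a (Suc (k + m))) / real b * (1 / real b) ^ k" for k
    using b by (simp add: f_def power_add field_simps)
  have scaled: "summable (\<lambda>k. real b ^ m * f (k + m))"
    using summable by (rule summable_mult)
  have tail: "real b ^ m * (\<Sum>k. f (k + m)) = (\<Sum>k. real b ^ m * f (k + m))"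
    using suminf_mult[OF summable, of "real b ^ m"] by simp
  have "(\<Sum>k. real b ^ m * f (k + m)) \<ge> 0"
    by (rule suminf_nonneg[OF scaled]) (simp add: tail_term)
  moreover have "(\<Sum>k. real b ^ m * f (k + m)) \<le> (\<Sum>k. (real b - 1) / real b * (1 / real b) ^ k)"
  proof (rule suminf_le[OF _ scaled])
    fix k
    have "real (a (Suc (k + m))) \<le> real b - 1"
      using digit[of "k + m"] by linarith
    then show "real b ^ m * f (k + m) \<le> (real b - 1) / real b * (1 / real b) ^ k"
      unfolding tail_term by (intro mult_right_mono divide_right_mono) auto
  qed (use geom in \<open>simp add: sums_iff\<close>)
  ultimately have "0 \<le> real b ^ m * (\<Sum>k. f (k + m))" "real b ^ m * (\<Sum>k. f (k + m)) \<le> 1"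
    using geom by (simp_all add: tail sums_iff)
  then show "real (S m) \<le> real b ^ m * x" "real b ^ m * x \<le> real (S m) + 1"
    by (simp_all add: x distrib_left head)
qed

text \<open>
  A remainder \<open>\<theta>\<close> strictly between \<open>0\<close> and \<open>1\<close> keeps \<open>b ^ m * x\<close> away from the
  integers, which removes the ambiguity left by the closed bounds.
\<close>

lemma base_expansion_truncation:
  assumes "is_base_expansion b a x" "b \<ge> 2"
    and approx: "real q * (real b ^ m * x) = real P + \<theta>" and \<theta>: "0 < \<theta>" "\<theta> < 1"
    and q: "q > 0"
  shows "(\<Sum>i<m. a (Suc i) * b ^ (m - Suc i)) = P div q"
proof -
  define S where "S = (\<Sum>i<m. a (Suc i) * b ^ (m - Suc i))"
  have "real q * real S \<le> real q * (real b ^ m * x)"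
       "real q * (real b ^ m * x) \<le> real q * (real S + 1)"
    using base_expansion_truncation_bounds[OF assms(1,2), of m]
    by (auto simp: S_def intro!: mult_left_mono)
  with approx \<theta> have "real (q * S) < real (P + 1)" "real P < real (q * (S + 1))"
    by (simp_all add: algebra_simps)
  then have "q * S \<le> P" "P < q * (S + 1)"
    by (simp_all only: of_nat_less_iff)
  then have "P div q = S"
    by (intro div_nat_eqI) (simp_all add: algebra_simps)
  then show ?thesis
    by (simp add: S_def)
qed

text \<open>
  Passing from \<open>m\<close> to \<open>Suc m\<close> multiplies the truncation by \<open>b\<close> and adds the new digit;
  both truncations are integer quotients, and the digit is what the division by \<open>q\<close>
  carries over from the remainder \<open>P mod q\<close>.
\<close>

lemma base_expansion_digit:
  assumes exp: "is_base_expansion b a x" and b: "b \<ge> 2"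
    and now: "real q * (real b ^ m * x) = real P + \<theta>" "0 < \<theta>" "\<theta> < 1"
    and succ: "real q * (real b ^ Suc m * x) = real (b * P) + \<theta>'" "0 < \<theta>'" "\<theta>' < 1"
    and q: "q > 0"
  shows "a (Suc m) = b * (P mod q) div q"
proof -
  have "(\<Sum>i<Suc m. a (Suc i) * b ^ (Suc m - Suc i))
      = b * (\<Sum>i<m. a (Suc i) * b ^ (m - Suc i)) + a (Suc m)"
    by (auto simp: sum_distrib_left Suc_diff_Suc intro!: sum.cong
        simp flip: power_Suc mult.assoc)
  then have "b * P div q = b * (P div q) + a (Suc m)"
    using base_expansion_truncation[OF exp b now q]
      base_expansion_truncation[OF exp b succ q] by simp
  moreover have "b * P = b * (P mod q) + b * (P div q) * q"
    by (metis add.commute distrib_left mod_mult_div_eq mult.assoc mult.commute)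
  then have "b * P div q = b * (P mod q) div q + b * (P div q)"
    using q by simp
  ultimately show ?thesis
    by simp
qed

section \<open>The digits of a Stoneham number\<close>

text \<open>
  The numerator, over the denominator \<open>c ^ N\<close>, of \<open>b ^ m\<close> times the sum of the first
  \<open>N\<close> terms of the Stoneham series. The truncated subtractions in the exponents are exact
  for \<open>c ^ N \<le> m\<close>.
\<close>

definition stoneham_numerator :: "nat \<Rightarrow> nat \<Rightarrow> nat \<Rightarrow> nat \<Rightarrow> nat" where
  "stoneham_numerator b c N m = (\<Sum>n<N. c ^ (N - Suc n) * b ^ (m - c ^ Suc n))"

lemma stoneham_numerator_shift:
  assumes "c > 0" "c ^ N \<le> m"
  shows "stoneham_numerator b c N (m + j) = b ^ j * stoneham_numerator b c N m"
  unfolding stoneham_numerator_def sum_distrib_left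
proof (rule sum.cong)
  fix n assume "n \<in> {..<N}"
  then have "c ^ Suc n \<le> c ^ N"
    using assms by (intro power_increasing) auto
  then have "m + j - c ^ Suc n = (m - c ^ Suc n) + j"
    using assms by linarith
  then show "c ^ (N - Suc n) * b ^ (m + j - c ^ Suc n)
      = b ^ j * (c ^ (N - Suc n) * b ^ (m - c ^ Suc n))"
    by (simp only: power_add ac_simps)
qed simp

text \<open>Modulo \<open>c\<close> only the last summand survives, and it is a power of \<open>b\<close>.\<close>

lemma coprime_stoneham_numerator:
  assumes "coprime b c"
  shows "coprime (stoneham_numerator b c (Suc N) m) c"
proof -
  have "c dvd (\<Sum>n<N. c ^ (Suc N - Suc n) * b ^ (m - c ^ Suc n))"
    by (intro dvd_sum) auto
  then obtain d where "(\<Sum>n<N. c ^ (Suc N - Suc n) * b ^ (m - c ^ Suc n)) = d * c"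
    by (metis dvd_def mult.commute)
  then have "stoneham_numerator b c (Suc N) m = d * c + b ^ (m - c ^ Suc N)"
    by (simp add: stoneham_numerator_def)
  moreover have "coprime (b ^ (m - c ^ Suc N)) c"
    using assms by simp
  ultimately show ?thesis
    by (metis gcd_add_mult coprime_iff_gcd_eq_1 gcd.commute)
qed

text \<open>
  The terms beyond the first \<open>N\<close> contribute little: multiplied by \<open>c ^ N * b ^ m\<close>, the
  term with index \<open>N + k\<close> is at most \<open>c\<close> to the power \<open>- (k + 1)\<close> because
  \<open>m \<le> c ^ Suc N\<close>, and these powers add up to at most \<open>1\<close>. For \<open>c = 2\<close> this geometric
  bound equals \<open>1\<close>; strictness comes from the exponentially small factor in the term
  with \<open>k = 1\<close>.
\<close>

lemma scaled_stoneham_decomposition: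
  assumes b: "b \<ge> 2" and c: "c \<ge> 2" and m: "c ^ N \<le> m" "m \<le> c ^ Suc N"
  obtains \<theta> where
    "real (c ^ N) * (real b ^ m * stoneham b c) = real (stoneham_numerator b c N m) + \<theta>"
    "0 < \<theta>" "\<theta> < 1"
proof -
  define f where "f = (\<lambda>n. 1 / (real c ^ Suc n * real b ^ (c ^ Suc n)))"
  define K where "K = real (c ^ N) * real b ^ m"
  have f_pos: "f n > 0" for n
    using b c by (simp add: f_def)
  have K_pos: "K > 0"
    using b c by (simp add: K_def)
  have half: "(1 / real c) ^ Suc n \<le> (1 / 2) ^ Suc n" for n
    using c by (intro power_mono) (auto simp: field_simps)
  have "f n \<le> (1 / 2) ^ Suc n" for n
  proof -
    have "f n = (1 / real c) ^ Suc n * (1 / real b ^ (c ^ Suc n))"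
      by (simp add: f_def power_divide)
    also have "\<dots> \<le> (1 / real c) ^ Suc n"
      using b by (intro mult_left_le) (auto simp: field_simps one_le_power)
    also note half
    finally show ?thesis .
  qed
  then have summable: "summable f"
    using f_pos sums_summable[OF power_half_series]
    by (intro summable_comparison_test_ev[of f]) (auto simp: less_imp_le simp del: power_Suc)
  define g where "g = (\<lambda>k. K * f (k + N))"
  have g_eq: "g k = (1 / real c) ^ Suc k * (real b ^ m / real b ^ (c ^ Suc (k + N)))" for k
    using c by (simp add: g_def f_def K_def power_add field_simps)
  have exponent: "c ^ Suc N \<le> c ^ Suc (k + N)" for k
    using c by (intro power_increasing) auto
  have g_le: "g k \<le> (1 / 2) ^ Suc k" for k
  proof -
    have "real b ^ m \<le> real b ^ (c ^ Suc (k + N))"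
      using b order_trans[OF m(2) exponent[of k]] by (intro power_increasing) auto
    then have "g k \<le> (1 / real c) ^ Suc k"
      unfolding g_eq using b by (intro mult_left_le) auto
    also note half
    finally show ?thesis .
  qed
  have "c ^ Suc N < c ^ Suc (1 + N)"
    using c by (intro power_strict_increasing) auto
  with m have "m < c ^ Suc (1 + N)"
    by linarith
  then have "real b ^ m < real b ^ (c ^ Suc (1 + N))"
    using b by (intro power_strict_increasing) auto
  then have "g 1 < (1 / real c) ^ Suc 1 * 1"
    unfolding g_eq using b c by (intro mult_strict_left_mono) auto
  then have g_less: "g 1 < (1 / 2) ^ Suc 1"
    using half[of 1] by linarith
  have g_summable: "summable g"
    unfolding g_def using summable by (intro summable_mult summable_ignore_initial_segment)
  have "0 < (\<Sum>k. (1 / 2) ^ Suc k - g k)"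
    using g_le g_less power_half_series
    by (intro suminf_pos2[where i = 1] summable_diff[OF _ g_summable]) (auto simp: sums_iff)
  also have "\<dots> = 1 - (\<Sum>k. g k)"
    using suminf_diff[OF _ g_summable] power_half_series by (metis sums_iff)
  finally have "(\<Sum>k. g k) < 1"
    by simp
  moreover have "(\<Sum>k. g k) > 0"
    using g_summable K_pos f_pos by (intro suminf_pos) (auto simp: g_def)
  moreover have "real (c ^ N) * (real b ^ m * stoneham b c)
      = real (stoneham_numerator b c N m) + (\<Sum>k. g k)"
  proof -
    have "real (c ^ N) * (real b ^ m * stoneham b c) = K * (\<Sum>n. f n)"
      by (simp add: K_def stoneham_def f_def)
    also have "(\<Sum>n. f n) = (\<Sum>k. f (k + N)) + (\<Sum>n<N. f n)"
      by (rule suminf_split_initial_segment[OF summable])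
    also have "K * \<dots> = (\<Sum>k. g k) + (\<Sum>n<N. K * f n)"
      using summable
      by (simp add: g_def distrib_left sum_distrib_left suminf_mult summable_ignore_initial_segment)
    also have "(\<Sum>n<N. K * f n) = real (stoneham_numerator b c N m)"
      unfolding stoneham_numerator_def of_nat_sum
    proof (rule sum.cong)
      fix n assume n: "n \<in> {..<N}"
      then have "c ^ Suc n \<le> c ^ N"
        using c by (intro power_increasing) auto
      with m have "c ^ Suc n \<le> m"
        by linarith
      then have "real b ^ m = real b ^ (m - c ^ Suc n) * real b ^ (c ^ Suc n)"
        by (simp flip: power_add)
      moreover have "real c ^ N = real c ^ (N - Suc n) * real c ^ Suc n"
        using n by (simp del: power_Suc flip: power_add)
      ultimately show "K * f n = real (c ^ (N - Suc n) * b ^ (m - c ^ Suc n))"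
        using b c by (simp add: K_def f_def)
    qed simp
    finally show ?thesis
      by simp
  qed
  ultimately show thesis
    using that by blast
qed

lemma stoneham_digit:
  assumes exp: "is_base_expansion b a (stoneham b c)" and b: "b \<ge> 2" and c: "c \<ge> 2"
    and j: "c ^ N + j < c ^ Suc N"
  shows "a (Suc (c ^ N + j))
    = b * (b ^ j * stoneham_numerator b c N (c ^ N) mod c ^ N) div c ^ N"
proof -
  let ?m = "c ^ N + j"
  let ?P = "stoneham_numerator b c N"
  obtain \<theta> where \<theta>: "real (c ^ N) * (real b ^ ?m * stoneham b c) = real (?P ?m) + \<theta>"
    "0 < \<theta>" "\<theta> < 1"
    using scaled_stoneham_decomposition[OF b c, of N ?m] j by auto
  obtain \<theta>' where \<theta>':
    "real (c ^ N) * (real b ^ Suc ?m * stoneham b c) = real (?P (Suc ?m)) + \<theta>'"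
    "0 < \<theta>'" "\<theta>' < 1"
    using scaled_stoneham_decomposition[OF b c, of N "Suc ?m"] j by auto
  have "?P (Suc ?m) = b * ?P ?m"
    using stoneham_numerator_shift[of c N ?m b 1] c by simp
  then have "a (Suc ?m) = b * (?P ?m mod c ^ N) div c ^ N"
    using \<theta>' c by (intro base_expansion_digit[OF exp b \<theta>, of \<theta>']) simp_all
  then show ?thesis
    using c by (simp add: stoneham_numerator_shift)
qed

lemma stoneham_digit_periodic:
  assumes exp: "is_base_expansion b a (stoneham b c)" and b: "b \<ge> 2" and c: "c \<ge> 2"
    and coprime: "coprime b c"
    and j: "j \<ge> 1" "c ^ N + j + t * totient (c ^ N) \<le> c ^ Suc N"
  shows "a (c ^ N + j + t * totient (c ^ N)) = a (c ^ N + j)"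
proof -
  let ?q = "c ^ N" and ?P = "stoneham_numerator b c N (c ^ N)"
  obtain i where i: "j = Suc i"
    using j by (cases j) auto
  have "[b ^ totient ?q = 1] (mod ?q)"
    using coprime by (intro euler_theorem) simp
  then have "[(b ^ totient ?q) ^ t * (b ^ i * ?P) = 1 ^ t * (b ^ i * ?P)] (mod ?q)"
    by (intro cong_mult cong_pow cong_refl)
  then have "b ^ (i + t * totient ?q) * ?P mod ?q = b ^ i * ?P mod ?q"
    by (simp add: cong_def power_add mult_ac flip: power_mult)
  then show ?thesis
    using stoneham_digit[OF exp b c, of N i] stoneham_digit[OF exp b c, of N "i + t * totient ?q"] i j
    by (simp add: add.assoc)
qed

section \<open>Residues visited in one period\<close>

text \<open>
  The powers of a primitive root exhaust the units, and multiplication by a fixed unit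
  permutes them.
\<close>

lemma residue_primroot_orbit_bij_betw:
  assumes g: "residue_primroot q g" and u: "coprime u q" and q: "q > 1"
  shows "bij_betw (\<lambda>j. g ^ j * u mod q) {..<totient q} (totatives q)"
proof -
  have "coprime q g" and ord: "ord q g = totient q"
    using g by (auto simp: residue_primroot_def)
  have inj: "inj_on (\<lambda>j. g ^ j * u mod q) {..<totient q}"
  proof (rule inj_onI)
    fix i j assume ij: "i \<in> {..<totient q}" "j \<in> {..<totient q}"
      and "g ^ i * u mod q = g ^ j * u mod q"
    then have "g ^ i mod q = g ^ j mod q"
      using u cong_mult_rcancel_nat[of u q] by (simp add: cong_def)
    with ij show "i = j"
      using inj_power_mod[OF \<open>coprime q g\<close>] by (auto simp: ord dest: inj_onD)
  qed
  have subset: "(\<lambda>j. g ^ j * u mod q) ` {..<totient q} \<subseteq> totatives q"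
  proof clarify
    fix j
    have "coprime (g ^ j * u mod q) q"
      using \<open>coprime q g\<close> u q by (simp add: coprime_commute)
    moreover from this have "g ^ j * u mod q > 0"
      using q by (intro gr0I) auto
    ultimately show "g ^ j * u mod q \<in> totatives q"
      using q by (simp add: in_totatives_iff less_imp_le)
  qed
  have "card ((\<lambda>j. g ^ j * u mod q) ` {..<totient q}) = card (totatives q)"
    using card_image[OF inj] by (simp add: totient_def)
  with inj subset show ?thesis
    unfolding bij_betw_def by (metis card_subset_eq finite_totatives)
qed

text \<open>
  The order of \<open>3\<close> is \<open>4\<close> modulo \<open>5\<close>, and \<open>3 ^ 4 = 81\<close> is not \<open>1\<close> modulo \<open>25\<close>; this
  suffices for all powers of \<open>5\<close>.
\<close>

lemma residue_primroot_5_power_3: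
  assumes "k > 0"
  shows "residue_primroot (5 ^ k) 3"
proof -
  have coprime: "coprime 5 (3::nat)"
    by (simp add: coprime_iff_gcd_eq_1 gcd_non_0_nat)
  have prime: "prime (5::nat)"
    by simp
  have "ord 5 (3::nat) = 4"
  proof -
    have "ord 5 (3::nat) dvd 4"
      by (simp add: cong_def flip: ord_divides)
    then have "ord 5 (3::nat) \<le> 4"
      by (rule dvd_imp_le) simp
    moreover have "\<not> ord 5 (3::nat) dvd 2"
      by (simp add: cong_def flip: ord_divides)
    moreover have "\<not> (3::nat) dvd 4"
      by presburger
    moreover have "x = 0 \<or> x = 1 \<or> x = 2 \<or> x = 3 \<or> x = 4" if "x \<le> 4" for x :: nat
      using that by linarith
    ultimately show ?thesis
      using \<open>ord 5 (3::nat) dvd 4\<close> by (metis dvd_0_left_iff dvd_refl one_dvd zero_neq_numeral)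
  qed
  then have "residue_primroot 5 3"
    using coprime prime by (simp add: residue_primroot_def totient_prime)
  then show ?thesis
    using residue_primroot_prime_lift_iff[OF prime, of 3] assms by (simp add: cong_def)
qed

section \<open>The exponential sum over the leading ternary digits\<close>

text \<open>
  The three runs of equal leading digit have lengths \<open>k + 1\<close>, \<open>k\<close>, \<open>k\<close> for \<open>M = 3 * k + 1\<close>
  and \<open>k + 1\<close>, \<open>k + 1\<close>, \<open>k\<close> for \<open>M = 3 * k + 2\<close>; \<open>k\<close> of each cancel.
\<close>

lemma sum_power_leading_ternary_digit:
  fixes \<omega> :: "'a :: comm_ring_1"
  assumes root: "1 + \<omega> + \<omega>\<^sup>2 = 0" and M: "\<not> 3 dvd M"
  shows "(\<Sum>r<M. \<omega> ^ (3 * r div M)) = (if M mod 3 = 1 then 1 else 1 + \<omega>)"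
proof -
  define k e where "k = M div 3" and "e = (if M mod 3 = 1 then 0 else 1 :: nat)"
  have M_eq: "M = 3 * k + 1 + e"
    using M by (auto simp: k_def e_def dvd_eq_mod_eq_0) presburger+
  have e: "e \<le> 1"
    by (simp add: e_def)
  have "(\<Sum>r<M. \<omega> ^ (3 * r div M))
      = (\<Sum>r\<in>{0..<k + 1}. \<omega> ^ (3 * r div M)) + (\<Sum>r\<in>{k + 1..<2 * k + 1 + e}. \<omega> ^ (3 * r div M))
        + (\<Sum>r\<in>{2 * k + 1 + e..<M}. \<omega> ^ (3 * r div M))"
    using sum.atLeastLessThan_concat[of 0 "k + 1" "2 * k + 1 + e" "\<lambda>r. \<omega> ^ (3 * r div M)"]
      sum.atLeastLessThan_concat[of 0 "2 * k + 1 + e" M "\<lambda>r. \<omega> ^ (3 * r div M)"] M_eq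
    by (simp only: lessThan_atLeast0)
  also have "(\<Sum>r\<in>{0..<k + 1}. \<omega> ^ (3 * r div M)) = (\<Sum>r\<in>{0..<k + 1}. 1)"
    by (rule sum.cong) (auto simp: M_eq)
  also have "(\<Sum>r\<in>{k + 1..<2 * k + 1 + e}. \<omega> ^ (3 * r div M)) = (\<Sum>r\<in>{k + 1..<2 * k + 1 + e}. \<omega>)"
  proof (rule sum.cong)
    fix r assume "r \<in> {k + 1..<2 * k + 1 + e}"
    then have "3 * r div M = 1"
      using e by (intro div_nat_eqI) (auto simp: M_eq)
    then show "\<omega> ^ (3 * r div M) = \<omega>"
      by simp
  qed simp
  also have "(\<Sum>r\<in>{2 * k + 1 + e..<M}. \<omega> ^ (3 * r div M)) = (\<Sum>r\<in>{2 * k + 1 + e..<M}. \<omega>\<^sup>2)"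
  proof (rule sum.cong)
    fix r assume "r \<in> {2 * k + 1 + e..<M}"
    then have "3 * r div M = 2"
      using e by (intro div_nat_eqI) (auto simp: M_eq)
    then show "\<omega> ^ (3 * r div M) = \<omega>\<^sup>2"
      by simp
  qed simp
  also have "(\<Sum>r\<in>{0..<k + 1}. 1) + (\<Sum>r\<in>{k + 1..<2 * k + 1 + e}. \<omega>)
      + (\<Sum>r\<in>{2 * k + 1 + e..<M}. \<omega>\<^sup>2) = of_nat k * (1 + \<omega> + \<omega>\<^sup>2) + 1 + of_nat e * \<omega>"
    by (simp add: M_eq algebra_simps)
  finally show ?thesis
    using root by (simp add: e_def)
qed

text \<open>
  The non-units below \<open>p * M\<close> are the numbers \<open>p * s\<close> with \<open>s < M\<close>, and \<open>p * s\<close> has the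
  same leading digit relative to \<open>p * M\<close> as \<open>s\<close> has relative to \<open>M\<close>.
\<close>

lemma sum_totatives_prime_power:
  fixes F :: "nat \<Rightarrow> 'a :: ab_group_add"
  assumes p: "prime p"
  shows "(\<Sum>r\<in>totatives (p ^ Suc n). F (b * r div p ^ Suc n))
    = (\<Sum>r<p ^ Suc n. F (b * r div p ^ Suc n)) - (\<Sum>s<p ^ n. F (b * s div p ^ n))"
proof -
  let ?q = "p ^ Suc n"
  have p1: "p > 1"
    using p by (rule prime_gt_1_nat)
  have q1: "?q > 1"
    using p1 by (rule one_less_power) simp
  have coprime_iff: "coprime r ?q \<longleftrightarrow> \<not> p dvd r" for r
    using p by (auto simp: coprime_commute intro: prime_imp_coprime dest: coprime_common_divisor)
  have totatives: "totatives ?q = {..<?q} - (*) p ` {..<p ^ n}"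
  proof (intro equalityI subsetI)
    fix r assume r: "r \<in> totatives ?q"
    then have "r < ?q"
      using q1 by (rule totatives_less)
    moreover have "\<not> p dvd r"
      using r coprime_iff by (simp add: in_totatives_iff)
    ultimately show "r \<in> {..<?q} - (*) p ` {..<p ^ n}"
      by auto
  next
    fix r assume r: "r \<in> {..<?q} - (*) p ` {..<p ^ n}"
    have "\<not> p dvd r"
    proof
      assume "p dvd r"
      then obtain s where "r = p * s" ..
      with r p1 show False
        by auto
    qed
    moreover from this have "r > 0"
      by (intro gr0I) auto
    ultimately show "r \<in> totatives ?q"
      using r coprime_iff by (simp add: in_totatives_iff)
  qed
  have "(*) p ` {..<p ^ n} \<subseteq> {..<?q}"
    using p1 by auto
  then have "(\<Sum>r\<in>totatives ?q. F (b * r div ?q))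
      = (\<Sum>r<?q. F (b * r div ?q)) - (\<Sum>r\<in>(*) p ` {..<p ^ n}. F (b * r div ?q))"
    unfolding totatives by (intro sum_diff) auto
  also have "(\<Sum>r\<in>(*) p ` {..<p ^ n}. F (b * r div ?q)) = (\<Sum>s<p ^ n. F (b * (p * s) div ?q))"
    using p1 by (subst sum.reindex) (auto simp: inj_on_def)
  also have "\<dots> = (\<Sum>s<p ^ n. F (b * s div p ^ n))"
  proof (rule sum.cong)
    fix s
    have "b * (p * s) div ?q = p * (b * s) div (p * p ^ n)"
      by (simp add: ac_simps)
    also have "\<dots> = b * s div p ^ n"
      using p1 by simp
    finally show "F (b * (p * s) div ?q) = F (b * s div p ^ n)"
      by simp
  qed simp
  finally show ?thesis .
qed

lemma power_5_mod_3: "(5::nat) ^ n mod 3 = (if even n then 1 else 2)"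
proof (induction n)
  case (Suc n)
  have "(5::nat) ^ Suc n mod 3 = 5 * (5 ^ n mod 3) mod 3"
    by (simp add: mod_mult_right_eq)
  with Suc show ?case
    by simp
qed simp

text \<open>
  From \<open>5 ^ n\<close> to \<open>5 ^ Suc n\<close> the complete sum passes from \<open>1\<close> to \<open>1 + \<omega>\<close> for even \<open>n\<close>
  and back for odd \<open>n\<close>.
\<close>

lemma sum_totatives_leading_ternary_digit:
  fixes \<omega> :: "'a :: comm_ring_1"
  assumes "1 + \<omega> + \<omega>\<^sup>2 = 0"
  shows "(\<Sum>r\<in>totatives (5 ^ Suc n). \<omega> ^ (3 * r div 5 ^ Suc n)) = (- 1) ^ n * \<omega>"
proof -
  have not_dvd: "\<not> 3 dvd (5::nat) ^ k" for k
    by (simp add: dvd_eq_mod_eq_0 power_5_mod_3)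
  show ?thesis
    using sum_totatives_prime_power[of 5 "\<lambda>d. \<omega> ^ d" 3 n]
      sum_power_leading_ternary_digit[OF assms not_dvd[of n]]
      sum_power_leading_ternary_digit[OF assms not_dvd[of "Suc n"]]
    by (simp add: power_5_mod_3 del: power_Suc)
qed

lemma cube_root_of_unity_sum:
  defines "\<omega> \<equiv> exp (2 * complex_of_real pi * \<i> / 3)"
  shows "1 + \<omega> + \<omega>\<^sup>2 = 0"
proof -
  have "\<omega> = cis (2 * pi / 3)"
    by (simp add: \<omega>_def cis_conv_exp mult_ac)
  then have eq: "\<omega> = Complex (- 1 / 2) (sqrt 3 / 2)"
    by (simp add: complex_eq_iff cos_120 sin_120)
  show ?thesis
    by (simp add: eq complex_eq_iff power2_eq_square)
qed

theorem theorem1p2: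
  fixes a :: "nat \<Rightarrow> nat"
  assumes "is_base_expansion 3 a (stoneham 3 5)"
  shows "\<forall>n::nat.
      (\<Sum>k = 5 ^ (n + 1) + 1..5 ^ (n + 1) + 4 * 5 ^ n. exp (2 * complex_of_real pi * \<i> / 3) ^ a k)
        = (- 1) ^ n * exp (2 * complex_of_real pi * \<i> / 3)
    \<and> (\<forall>j\<in>{1..4 * 5 ^ n}. \<forall>k. k = 5 ^ (n + 1) + j \<longrightarrow>
        a k = a (4 * 5 ^ n + k) \<and> a k = a (8 * 5 ^ n + k) \<and>
        a k = a (12 * 5 ^ n + k) \<and> a k = a (16 * 5 ^ n + k))"
proof (intro allI conjI ballI impI)
  fix n :: nat
  define \<omega> where "\<omega> = exp (2 * complex_of_real pi * \<i> / 3)"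
  define q :: nat where "q = 5 ^ Suc n"
  define u where "u = stoneham_numerator 3 5 (Suc n) q"
  have coprime: "coprime 3 (5::nat)"
    by (simp add: coprime_iff_gcd_eq_1 gcd_non_0_nat)
  have tot: "totient q = 4 * 5 ^ n"
    by (simp add: q_def totient_prime_power_Suc del: power_Suc)
  have q1: "q > 1"
    unfolding q_def by (rule one_less_power) auto
  have u: "coprime u q"
    using coprime_stoneham_numerator[OF coprime, of n q] by (simp add: u_def q_def)
  have digit: "a (Suc (q + j)) = 3 * (3 ^ j * u mod q) div q" if "j < totient q" for j
    unfolding u_def q_def
    using that tot by (intro stoneham_digit[OF assms]) (simp_all add: q_def)
  have bij: "bij_betw (\<lambda>j. 3 ^ j * u mod q) {..<totient q} (totatives q)"
    using u q1 by (intro residue_primroot_orbit_bij_betw)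
      (simp_all add: q_def residue_primroot_5_power_3 del: power_Suc)
  have "(\<Sum>k = q + 1..q + totient q. \<omega> ^ a k) = (\<Sum>j<totient q. \<omega> ^ a (Suc (q + j)))"
    by (rule sum.reindex_bij_witness[of _ "\<lambda>j. Suc (q + j)" "\<lambda>k. k - Suc q"]) auto
  also have "\<dots> = (\<Sum>j<totient q. \<omega> ^ (3 * (3 ^ j * u mod q) div q))"
    by (rule sum.cong) (simp_all add: digit)
  also have "\<dots> = (\<Sum>r\<in>totatives q. \<omega> ^ (3 * r div q))"
    by (rule sum.reindex_bij_betw[OF bij])
  also have "\<dots> = (- 1) ^ n * \<omega>"
    unfolding q_def \<omega>_def
    by (rule sum_totatives_leading_ternary_digit[OF cube_root_of_unity_sum])
  finally show "(\<Sum>k = 5 ^ (n + 1) + 1..5 ^ (n + 1) + 4 * 5 ^ n.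
      exp (2 * complex_of_real pi * \<i> / 3) ^ a k)
      = (- 1) ^ n * exp (2 * complex_of_real pi * \<i> / 3)"
    by (simp add: \<omega>_def tot) (simp add: q_def)
  fix j k :: nat
  assume j: "j \<in> {1..4 * 5 ^ n}" and k: "k = 5 ^ (n + 1) + j"
  have period: "a k = a (t * (4 * 5 ^ n) + k)" if "t \<le> 4" for t
  proof -
    have "t * (4 * 5 ^ n) \<le> 4 * (4 * 5 ^ n :: nat)"
      using that by (rule mult_right_mono) simp
    then have "q + j + t * totient q \<le> 5 ^ Suc (Suc n)"
      using j unfolding tot unfolding q_def
      by (simp only: power_Suc atLeastAtMost_iff) linarith
    then show ?thesis
      using stoneham_digit_periodic[OF assms _ _ coprime, of j "Suc n" t] j tot
      by (simp add: q_def k add_ac)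
  qed
  show "a k = a (4 * 5 ^ n + k)" "a k = a (8 * 5 ^ n + k)"
    "a k = a (12 * 5 ^ n + k)" "a k = a (16 * 5 ^ n + k)"
    using period[of 1] period[of 2] period[of 3] period[of 4] by simp_all
qed

end
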